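(* Let $\lambda\ge 1$ be an integer and let $C\mathrm{Spin}(Arc(K))_{\lambda}$ be the $\lambda$-subcubical spun $2$-knot obtained from a $\lambda$-subcubical arc $Arc(K)$ with vertices $v_{1},v_{2},\dots,v_{n}\in(\frac{1}{\lambda}\mathbb{Z})^4$, where $v_{i}=(x_{i},y_{i},z_{i},0)$ and $\|v_{i+1}-v_{i}\|=\frac{1}{\lambda}$ for $1\le i\le n-1$. Then $$\mathrm{Area}\big(C\mathrm{Spin}(Arc(K))_{\lambda}\big)=\frac{8}{\lambda}\sum_{i=2}^{n-1}z_{i}.$$
   Context: **Subcubulation.** The canonical cubulation $\mathcal{C}$ of $\mathbb{R}^4$ is its decomposition into the integer translates of $[0,1]^4$. For an integer $\lambda\ge1$, $\mathcal{C}_\lambda$ is obtained by subdividing each $k$-cell of $\mathcal{C}$ into $\lambda^k$ congruent $k$-cells (of side $1/\lambda$), so its vertex set is $(\frac1\lambda\mathbb{Z})^4$. **Half-space.** $\mathbb{R}^3_+=\{(x_1,x_2,x_3,0):x_3\ge0\}\subset\mathbb{R}^4$, with boundary $\mathbb{R}^2=\{(x_1,x_2,0,0)\}$. **$\lambda$-subcubical arc.** This is an embedded arc in $\mathbb{R}^3_+$, contained in the 1-skeleton of $\mathcal{C}_\lambda$, with consecutive vertices $v_1,\dots,v_n\in(\frac1\lambda\mathbb{Z})^4$. Its edges $\overline{v_iv_{i+1}}$ are each parallel to one of the first three coordinate axes and have length $\frac1\lambda$. The end-points $v_1,v_n$ lie in $\mathbb{R}^2$, and $v_2,\dots,v_{n-1}$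 lie in $\mathbb{R}^3_+\setminus\mathbb{R}^2$. **$\lambda$-subcubical spun 2-knot.** $C\mathrm{Spin}(Arc(K))_\lambda$ is the embedded 2-sphere obtained from $\mathrm{Spin}(Arc(K))=\{(x,y,z\cos2\pi\theta,z\sin2\pi\theta):(x,y,z,0)\in Arc(K),\,0\le\theta\le1\}$ by replacing, for each point $(x,y,z,0)$ of the arc, the circle of radius $z$ centered at $(x,y,0,0)$ in the plane $\{(x,y)\}\times\mathbb{R}^2$ by the boundary of the axis-parallel square of side $2z$ with the same center. That is, $$C\mathrm{Spin}(Arc(K))_\lambda=\{(x,y,s,t)\in\mathbb{R}^4:(x,y,\max(|s|,|t|),0)\in Arc(K)\}.$$ Thus an edge parallel to the third axis contributes a square annulus (or a square, if one of its end-points lies in $\mathbb{R}^2$), and an edge parallel to the first or second axis contributes a square cylinder without its bottom and top covers. The result is contained in the 2-skeleton of $\mathcal{C}_\lambda$. $\mathrm{Area}$ denotes Euclidean 2-dimensional area. *)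

theory Defs
  imports "HOL-Analysis.Analysis"
begin

section \<open>Euclidean area of subsets of four-space\<close>

text \<open>Area is the two-dimensional Hausdorff measure, normalised so that the unit square has
  area 1; this is the same as the normalisation by the factor \<open>pi / 4\<close>. The division below is
  meaningful by \<open>hausdorff2_unit_square\<close>.

  Boundedness of the covering sets has to be demanded separately, because \<open>diameter\<close> has an
  unspecified value on unbounded sets.\<close>

definition hausdorff2_pre :: "real \<Rightarrow> 'a::metric_space set \<Rightarrow> ennreal" where
  "hausdorff2_pre \<delta> S =
     (INF U \<in> {U :: nat \<Rightarrow> 'a set. S \<subseteq> (\<Union>i. U i) \<and> (\<forall>i. bounded (U i) \<and> diameter (U i) \<le> \<delta>)}.
        \<Sum>i. ennreal ((diameter (U i))\<^sup>2))"

definition hausdorff2 :: "'a::metric_space set \<Rightarrow> ennreal" where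
  "hausdorff2 S = (SUP \<delta> \<in> {0<..}. hausdorff2_pre \<delta> S)"

definition unit_square :: "(real^4) set" where
  "unit_square = {x. 0 \<le> x$1 \<and> x$1 \<le> 1 \<and> 0 \<le> x$2 \<and> x$2 \<le> 1 \<and> x$3 = 0 \<and> x$4 = 0}"

definition area :: "(real^4) set \<Rightarrow> ennreal" where
  "area S = hausdorff2 S / hausdorff2 unit_square"

lemma vector_4 [simp]:
  "(vector [a,b,c,d] :: ('a::zero)^4) $ 1 = a"
  "(vector [a,b,c,d] :: ('a::zero)^4) $ 2 = b"
  "(vector [a,b,c,d] :: ('a::zero)^4) $ 3 = c"
  "(vector [a,b,c,d] :: ('a::zero)^4) $ 4 = d"
  unfolding vector_def by simp_all

lemma hausdorff2_pre_unit_square_lower: "1 \<le> 4 * hausdorff2_pre \<delta> unit_square"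
proof -
  have *: "1 / 4 \<le> (\<Sum>i. ennreal ((diameter (U i))\<^sup>2))"
    if sub: "unit_square \<subseteq> (\<Union>i. U i)" and bd: "\<And>i. bounded (U i)" for U :: "nat \<Rightarrow> (real^4) set"
  proof -
    define c where "c i = (SOME x. x \<in> U i)" for i
    define d where "d i = diameter (U i)" for i
    define B where "B i = cbox (c i $ 1 - d i, c i $ 2 - d i) (c i $ 1 + d i, c i $ 2 + d i)" for i
    have d0: "0 \<le> d i" for i unfolding d_def using bd by (simp add: diameter_ge_0)
    have comp: "\<bar>c i $ k - x $ k\<bar> \<le> d i" if "x \<in> U i" for i k x
    proof -
      have "c i \<in> U i" unfolding c_def using that by (metis someI)
      hence "dist (c i) x \<le> d i" unfolding d_def using that bd diameter_bounded_bound by blast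
      thus ?thesis
        using component_le_norm_cart[of "c i - x" k] by (simp add: dist_norm)
    qed
    have cov: "cbox (0::real,0::real) (1,1) \<subseteq> (\<Union>i. B i)"
    proof
      fix p :: "real \<times> real" assume p: "p \<in> cbox (0,0) (1,1)"
      have "(vector [fst p, snd p, 0, 0] :: real^4) \<in> unit_square"
        using p by (cases p) (auto simp: unit_square_def)
      then obtain i where i: "(vector [fst p, snd p, 0, 0] :: real^4) \<in> U i" using sub by blast
      have "p \<in> B i" using comp[OF i, of 1] comp[OF i, of 2]
        by (cases p) (auto simp: B_def)
      thus "p \<in> (\<Union>i. B i)" by blast
    qed
    have eB: "emeasure lborel (B i) = 4 * ennreal ((d i)\<^sup>2)" for i
    proof -
      have "emeasure lborel (B i) = ennreal ((2 * d i) * (2 * d i))"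
        unfolding B_def using d0[of i] by (auto simp: emeasure_lborel_cbox_eq Basis_prod_def
          prod.union_disjoint inner_prod_def)
      also have "\<dots> = 4 * ennreal ((d i)\<^sup>2)"
        by (simp add: power2_eq_square ennreal_mult' flip: ennreal_numeral)
      finally show ?thesis .
    qed
    have "1 = emeasure lborel (cbox (0::real,0::real) (1,1))"
      by (auto simp: emeasure_lborel_cbox_eq Basis_prod_def)
    also have "\<dots> \<le> emeasure lborel (\<Union>i. B i)"
      by (intro emeasure_mono cov) (auto simp: B_def)
    also have "\<dots> \<le> (\<Sum>i. emeasure lborel (B i))"
      by (intro emeasure_subadditive_countably) (auto simp: B_def)
    also have "\<dots> = 4 * (\<Sum>i. ennreal ((d i)\<^sup>2))"
      by (simp add: eB)
    finally have "1 \<le> 4 * (\<Sum>i. ennreal ((d i)\<^sup>2))" .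
    hence "1 / 4 \<le> (4 * (\<Sum>i. ennreal ((d i)\<^sup>2))) / 4"
      by (rule divide_right_mono_ennreal)
    also have "\<dots> = (\<Sum>i. ennreal ((d i)\<^sup>2))"
      by (subst mult.commute, rule ennreal_mult_divide_eq) auto
    finally show ?thesis unfolding d_def .
  qed
  have "1 / 4 \<le> hausdorff2_pre \<delta> unit_square"
    unfolding hausdorff2_pre_def by (intro INF_greatest *) auto
  hence "4 * (1 / 4) \<le> 4 * hausdorff2_pre \<delta> unit_square"
    by (rule mult_left_mono) simp
  thus ?thesis by (simp add: ennreal_times_divide ennreal_divide_self)
qed

lemma hausdorff2_pre_unit_square_upper:
  assumes "0 < \<delta>"
  shows "hausdorff2_pre \<delta> unit_square \<le> 4"
proof -
  obtain n0 :: nat where n0: "2 / \<delta> < real n0" using reals_Archimedean2 by blast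
  define n where "n = Suc n0"
  have n: "0 < n" "2 / real n \<le> \<delta>"
    using n0 assms by (auto simp: n_def field_simps intro: order.trans[of 2 "\<delta> * real n0"])
  define Q where "Q a b = {x \<in> unit_square. real a / n \<le> x$1 \<and> x$1 \<le> (real a + 1) / n \<and>
      real b / n \<le> x$2 \<and> x$2 \<le> (real b + 1) / n}" for a b :: nat
  define U where "U k = (if k < n * n then Q (k div n) (k mod n) else {})" for k
  have dist: "dist x y \<le> 2 / n" if "x \<in> Q a b" "y \<in> Q a b" for x y a b
  proof -
    have "norm (x - y) \<le> (\<Sum>i\<in>UNIV. \<bar>(x - y) $ i\<bar>)" by (rule norm_le_l1_cart)
    also have "\<dots> = \<bar>x$1 - y$1\<bar> + \<bar>x$2 - y$2\<bar>"
      using that by (simp add: sum_4 Q_def unit_square_def)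
    also have "\<dots> \<le> 1 / n + 1 / n"
      using that by (intro add_mono) (auto simp: Q_def add_divide_distrib)
    finally show ?thesis by (simp add: dist_norm)
  qed
  have dQ: "diameter (Q a b) \<le> 2 / n" for a b
    by (rule diameter_le) (use dist in \<open>auto simp: dist_norm\<close>)
  have bU: "bounded (U k)" for k
    unfolding U_def bounded_two_points using dist
    by (auto intro!: exI[of _ "2 / real n"])
  have dU: "diameter (U k) \<le> 2 / n" for k
    using dQ by (simp add: U_def)
  have cov: "unit_square \<subseteq> (\<Union>k. U k)"
  proof
    fix x :: "real^4" assume x: "x \<in> unit_square"
    have ex: "\<exists>a<n. real a / n \<le> t \<and> t \<le> (real a + 1) / n" if "0 \<le> t" "t \<le> 1" for t :: real
    proof (cases "t = 1")
      case True
      thus ?thesis using n by (intro exI[of _ "n - 1"]) (auto simp: of_nat_diff divide_simps)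
    next
      case False
      hence "t * n < n" using that n by simp
      hence "nat \<lfloor>t * n\<rfloor> < n" using that by (simp add: nat_less_iff floor_less_iff)
      moreover have "real (nat \<lfloor>t * n\<rfloor>) \<le> t * n" "t * n \<le> real (nat \<lfloor>t * n\<rfloor>) + 1"
        using mult_nonneg_nonneg[OF that(1) of_nat_0_le_iff[of n]] by simp_all
      ultimately show ?thesis using n by (intro exI[of _ "nat \<lfloor>t * n\<rfloor>"]) (auto simp: field_simps)
    qed
    obtain a where a: "a < n" "real a / n \<le> x$1" "x$1 \<le> (real a + 1) / n"
      using ex[of "x$1"] x by (auto simp: unit_square_def)
    obtain b where b: "b < n" "real b / n \<le> x$2" "x$2 \<le> (real b + 1) / n"
      using ex[of "x$2"] x by (auto simp: unit_square_def)
    have "a * n + b < n * n"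
    proof -
      have "a * n + b < (a + 1) * n" using b by simp
      also have "\<dots> \<le> n * n" using a by (intro mult_right_mono) auto
      finally show ?thesis .
    qed
    hence "x \<in> U (a * n + b)" using a b x n by (auto simp: U_def Q_def)
    thus "x \<in> (\<Union>k. U k)" by blast
  qed
  have "hausdorff2_pre \<delta> unit_square \<le> (\<Sum>k. ennreal ((diameter (U k))\<^sup>2))"
    unfolding hausdorff2_pre_def
    by (rule INF_lower) (use cov bU dU n in \<open>auto intro: order.trans\<close>)
  also have "\<dots> = (\<Sum>k<n*n. ennreal ((diameter (U k))\<^sup>2))"
    by (rule suminf_finite) (auto simp: U_def)
  also have "\<dots> \<le> (\<Sum>k<n*n. ennreal ((2 / n)\<^sup>2))"
    by (intro sum_mono ennreal_leI power_mono dU diameter_ge_0 bU)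
  also have "\<dots> = 4"
    using n by (simp add: power2_eq_square flip: ennreal_of_nat_eq_real_of_nat ennreal_mult'')
      (simp add: ennreal_of_nat_eq_real_of_nat flip: ennreal_mult ennreal_numeral)
  finally show ?thesis .
qed

lemma hausdorff2_unit_square: "0 < hausdorff2 unit_square" "hausdorff2 unit_square < \<infinity>"
proof -
  have "hausdorff2_pre 1 unit_square \<noteq> 0"
    using hausdorff2_pre_unit_square_lower[of 1] by auto
  moreover have "hausdorff2_pre 1 unit_square \<le> hausdorff2 unit_square"
    unfolding hausdorff2_def by (rule SUP_upper) simp
  ultimately show "0 < hausdorff2 unit_square"
    by (metis zero_less_iff_neq_zero less_le_trans)
  have "hausdorff2 unit_square \<le> 4"
    unfolding hausdorff2_def by (intro SUP_least hausdorff2_pre_unit_square_upper) auto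
  also have "\<dots> < \<infinity>" by simp
  finally show "hausdorff2 unit_square < \<infinity>" .
qed


section \<open>Subcubulations\<close>

text \<open>A \<open>k\<close>-cell is determined by its lowest corner \<open>a / lam\<close>, with \<open>a\<close> an integer vector, and
  the set \<open>I\<close> of the \<open>k\<close> coordinate directions in which it extends.\<close>

definition cell :: "nat \<Rightarrow> int^4 \<Rightarrow> 4 set \<Rightarrow> (real^4) set" where
  "cell lam a I = {x. \<forall>i. if i \<in> I then of_int (a$i) / real lam \<le> x$i \<and> x$i \<le> (of_int (a$i) + 1) / real lam
                                 else x$i = of_int (a$i) / real lam}"

definition skeleton :: "nat \<Rightarrow> nat \<Rightarrow> (real^4) set" where
  "skeleton lam k = \<Union>{cell lam a I | a I. card I \<le> k}"

definition lattice_points :: "nat \<Rightarrow> (real^4) set" where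
  "lattice_points lam = {x. \<forall>i. \<exists>m::int. x$i = of_int m / real lam}"


section \<open>Subcubical arcs and their spins\<close>

definition half_space :: "(real^4) set" where
  "half_space = {x. x$4 = 0 \<and> 0 \<le> x$3}"

definition half_space_boundary :: "(real^4) set" where
  "half_space_boundary = {x. x$3 = 0 \<and> x$4 = 0}"

fun polygonal_path :: "'a::real_normed_vector list \<Rightarrow> real \<Rightarrow> 'a" where
  "polygonal_path [] = (\<lambda>_. 0)"
| "polygonal_path [a] = linepath a a"
| "polygonal_path [a, b] = linepath a b"
| "polygonal_path (a # b # c # vs) = linepath a b +++ polygonal_path (b # c # vs)"

text \<open>The arc with consecutive vertices \<open>v 1, \<dots>, v n\<close>; other values of \<open>v\<close> are irrelevant.\<close>

definition vertex_path :: "(nat \<Rightarrow> real^4) \<Rightarrow> nat \<Rightarrow> real \<Rightarrow> real^4" where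
  "vertex_path v n = polygonal_path (map v [1..<Suc n])"

definition subcubical_arc :: "nat \<Rightarrow> (nat \<Rightarrow> real^4) \<Rightarrow> nat \<Rightarrow> bool" where
  "subcubical_arc lam v n \<longleftrightarrow>
     2 \<le> n \<and>
     arc (vertex_path v n) \<and>
     path_image (vertex_path v n) \<subseteq> half_space \<and>
     path_image (vertex_path v n) \<subseteq> skeleton lam 1 \<and>
     (\<forall>i\<in>{1..n}. v i \<in> lattice_points lam) \<and>
     (\<forall>i\<in>{1..n-1}. norm (v (i+1) - v i) = 1 / real lam \<and>
        (\<exists>j\<in>{1, 2, 3::4}. \<exists>c::real. v (i+1) - v i = c *\<^sub>R axis j 1)) \<and>
     v 1 \<in> half_space_boundary \<and> v n \<in> half_space_boundary \<and>
     (\<forall>i\<in>{2..n-1}. v i \<in> half_space - half_space_boundary)"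

definition cspin :: "(real^4) set \<Rightarrow> (real^4) set" where
  "cspin A = {x. vector [x$1, x$2, max \<bar>x$3\<bar> \<bar>x$4\<bar>, 0] \<in> A}"

end

theory Submission
  imports Defs
begin

text \<open>Hausdorff measure is additive on compact sets with null intersection, scales quadratically under
  similarities and vanishes on segments; hence rectangles have the expected area, and the area of
  the spin is the sum over the edges of the arc. An edge from height \<open>z\<close> to height \<open>z'\<close> contributes
  \<open>4 / lam * (z + z')\<close>: a vertical edge spins to a difference of two squares, a horizontal one to
  four rectangles. Summing along the arc counts every inner vertex twice, and the end-points have
  height 0.\<close>

section \<open>Additivity and scaling of the two-dimensional Hausdorff measure\<close>

text \<open>The value of \<open>hausdorff2 unit_square\<close> is never computed; it enters only as
  a positive finite constant that cancels in \<open>area\<close>, so rectangles must be measured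
  relative to the unit square. Additivity is derived directly from coverings, without measurability,
  in the generality in which the pieces of a spun arc meet. The contribution of an edge is expressed
  by the heights of both end-points because this form serves both directions:
  \<open>4 * z'^2 - 4 * z^2 = 4 * (z' - z) * (z' + z)\<close> with \<open>z' - z = 1 / lam\<close>
  for a rising vertical edge, and \<open>4 * (1 / lam) * (2 * z)\<close> with \<open>z' = z\<close>
  for a horizontal one. As infinite terms of \<open>ennreal\<close> do not cancel, every equation to
  be solved for an area is preceded by a finiteness argument and moved to the reals.\<close>

lemma diameter_le_dist:
  fixes S :: "'a::metric_space set"
  assumes "0 \<le> d" and "\<And>x y. x \<in> S \<Longrightarrow> y \<in> S \<Longrightarrow> dist x y \<le> d"
  shows "diameter S \<le> d"
proof (cases "S = {}")
  case False
  then have "(SUP (x, y)\<in>S \<times> S. dist x y) \<le> d"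
    using assms(2) by (intro cSUP_least) auto
  with False show ?thesis by (simp add: diameter_def)
qed (use assms(1) in simp)

lemma hausdorff2_pre_le:
  assumes "S \<subseteq> (\<Union>i. U i)" "\<And>i. bounded (U i)" "\<And>i. diameter (U i) \<le> \<delta>"
  shows "hausdorff2_pre \<delta> S \<le> (\<Sum>i::nat. ennreal ((diameter (U i))\<^sup>2))"
  unfolding hausdorff2_pre_def using assms by (intro INF_lower) auto

lemma hausdorff2_pre_lessE:
  assumes "hausdorff2_pre \<delta> S < e"
  obtains U :: "nat \<Rightarrow> 'a::metric_space set" where "S \<subseteq> (\<Union>i. U i)" "\<And>i. bounded (U i)" "\<And>i. diameter (U i) \<le> \<delta>"
    "(\<Sum>i. ennreal ((diameter (U i))\<^sup>2)) < e"
  using assms unfolding hausdorff2_pre_def INF_less_iff by blast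

lemma hausdorff2_pre_mono: "S \<subseteq> T \<Longrightarrow> hausdorff2_pre \<delta> S \<le> hausdorff2_pre \<delta> T"
  unfolding hausdorff2_pre_def by (intro INF_superset_mono) auto

lemma hausdorff2_pre_antimono: "\<delta> \<le> \<delta>' \<Longrightarrow> hausdorff2_pre \<delta>' S \<le> hausdorff2_pre \<delta> S"
  unfolding hausdorff2_pre_def by (intro INF_superset_mono) (auto intro: order.trans)

lemma hausdorff2_pre_le_hausdorff2: "0 < \<delta> \<Longrightarrow> hausdorff2_pre \<delta> S \<le> hausdorff2 S"
  unfolding hausdorff2_def by (intro SUP_upper) auto

lemma hausdorff2_mono: "S \<subseteq> T \<Longrightarrow> hausdorff2 S \<le> hausdorff2 T"
  unfolding hausdorff2_def by (intro SUP_mono) (auto intro: hausdorff2_pre_mono)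

text \<open>Two near-optimal coverings are merged into one sequence, with even indices for
  \<open>S\<close> and odd ones for \<open>T\<close>. Near-optimal coverings exist only for a finite
  premeasure; \<open>ennreal_le_epsilon\<close> supplies that finiteness.\<close>

lemma hausdorff2_pre_Un: "hausdorff2_pre \<delta> (S \<union> T) \<le> hausdorff2_pre \<delta> S + hausdorff2_pre \<delta> T"
proof (rule ennreal_le_epsilon)
  fix e :: real
  assume fin: "hausdorff2_pre \<delta> S + hausdorff2_pre \<delta> T < top" and e: "0 < e"
  have less: "x < x + ennreal (e / 2)" if "x < top" for x
    using ennreal_add_left_cancel_less[of x 0 "ennreal (e / 2)"] that e by auto
  obtain U where
    U: "S \<subseteq> (\<Union>i. U i)" "\<And>i. bounded (U i)" "\<And>i. diameter (U i) \<le> \<delta>"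
      "(\<Sum>i::nat. ennreal ((diameter (U i))\<^sup>2)) < hausdorff2_pre \<delta> S + ennreal (e / 2)"
    by (rule hausdorff2_pre_lessE[OF less[of "hausdorff2_pre \<delta> S"]]) (use fin in auto)
  obtain V where
    V: "T \<subseteq> (\<Union>i. V i)" "\<And>i. bounded (V i)" "\<And>i. diameter (V i) \<le> \<delta>"
      "(\<Sum>i::nat. ennreal ((diameter (V i))\<^sup>2)) < hausdorff2_pre \<delta> T + ennreal (e / 2)"
    by (rule hausdorff2_pre_lessE[OF less[of "hausdorff2_pre \<delta> T"]]) (use fin in auto)
  define W where "W k = (if even k then U (k div 2) else V (k div 2))" for k
  let ?d = "\<lambda>A. ennreal ((diameter A)\<^sup>2)"
  have cov: "S \<union> T \<subseteq> (\<Union>k. W k)"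
  proof
    fix x assume "x \<in> S \<union> T"
    then consider i where "x \<in> U i" | i where "x \<in> V i" using U(1) V(1) by blast
    then show "x \<in> (\<Union>k. W k)"
    proof cases
      case (1 i)
      then have "x \<in> W (2 * i)" by (simp add: W_def)
      then show ?thesis by blast
    next
      case (2 i)
      then have "x \<in> W (2 * i + 1)" by (simp add: W_def)
      then show ?thesis by blast
    qed
  qed
  have "(\<Sum>k. ?d (W k)) \<le> (\<Sum>i. ?d (U i)) + (\<Sum>i. ?d (V i))"
    unfolding suminf_eq_SUP[of "\<lambda>k. ?d (W k)"]
  proof (rule SUP_least)
    fix n
    \<comment> \<open>With an even number of terms the partial sum splits exactly into
      \<open>n\<close> terms of each covering.\<close>
    have "(\<Sum>k<n. ?d (W k)) \<le> (\<Sum>k<2*n. ?d (W k))" by (intro sum_mono2) auto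
    also have "\<dots> = (\<Sum>i<n. ?d (U i)) + (\<Sum>i<n. ?d (V i))"
      by (induction n) (auto simp: W_def ac_simps)
    also have "\<dots> \<le> (\<Sum>i. ?d (U i)) + (\<Sum>i. ?d (V i))"
      by (intro add_mono sum_le_suminf) auto
    finally show "(\<Sum>k<n. ?d (W k)) \<le> (\<Sum>i. ?d (U i)) + (\<Sum>i. ?d (V i))" .
  qed
  moreover have "hausdorff2_pre \<delta> (S \<union> T) \<le> (\<Sum>k. ?d (W k))"
    using U V by (intro hausdorff2_pre_le cov) (auto simp: W_def)
  ultimately have "hausdorff2_pre \<delta> (S \<union> T)
      \<le> (hausdorff2_pre \<delta> S + ennreal (e / 2)) + (hausdorff2_pre \<delta> T + ennreal (e / 2))"
    using add_mono[OF less_imp_le[OF U(4)] less_imp_le[OF V(4)]] by (meson order.trans)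
  also have "\<dots> = hausdorff2_pre \<delta> S + hausdorff2_pre \<delta> T + (ennreal (e / 2) + ennreal (e / 2))"
    by (simp add: ac_simps)
  also have "ennreal (e / 2) + ennreal (e / 2) = ennreal e"
    using e by (simp flip: ennreal_plus)
  finally show "hausdorff2_pre \<delta> (S \<union> T) \<le> hausdorff2_pre \<delta> S + hausdorff2_pre \<delta> T + ennreal e" .
qed

lemma hausdorff2_Un: "hausdorff2 (S \<union> T) \<le> hausdorff2 S + hausdorff2 T"
  unfolding hausdorff2_def[of "S \<union> T"]
  by (intro SUP_least order.trans[OF hausdorff2_pre_Un] add_mono hausdorff2_pre_le_hausdorff2) auto

text \<open>A set of diameter at most \<delta> cannot meet both \<open>S\<close> and
  \<open>T\<close>, so an admissible covering of the union divides into a covering of each, with no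
  index charged twice.\<close>

lemma hausdorff2_pre_separated:
  assumes sep: "\<And>x y. x \<in> S \<Longrightarrow> y \<in> T \<Longrightarrow> \<delta> < dist x y"
  shows "hausdorff2_pre \<delta> S + hausdorff2_pre \<delta> T \<le> hausdorff2_pre \<delta> (S \<union> T)"
  unfolding hausdorff2_pre_def[of \<delta> "S \<union> T"]
proof (rule INF_greatest, clarify)
  fix U :: "nat \<Rightarrow> 'a set"
  let ?d = "\<lambda>A :: 'a set. ennreal ((diameter A)\<^sup>2)"
  \<comment> \<open>Sets missing \<open>R\<close> become empty instead of being dropped, which keeps
    the family a sequence; the empty set has diameter 0 and is admissible once \<delta> is
    nonnegative.\<close>
  let ?V = "\<lambda>R i. if U i \<inter> R = {} then {} else U i"
  assume cov: "S \<union> T \<subseteq> (\<Union>i. U i)" and bd: "\<forall>i. bounded (U i) \<and> diameter (U i) \<le> \<delta>"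
  have \<delta>: "0 \<le> \<delta>" using bd diameter_ge_0 order.trans by blast
  have cov': "R \<subseteq> (\<Union>i. ?V R i)" if R: "R \<subseteq> (\<Union>i. U i)" for R
  proof
    fix x assume x: "x \<in> R"
    then obtain i where "x \<in> U i" using R by blast
    then have "x \<in> ?V R i" using x by auto
    then show "x \<in> (\<Union>i. ?V R i)" by blast
  qed
  have "hausdorff2_pre \<delta> S + hausdorff2_pre \<delta> T \<le> (\<Sum>i. ?d (?V S i)) + (\<Sum>i. ?d (?V T i))"
    using cov bd \<delta> by (intro add_mono hausdorff2_pre_le cov') auto
  also have "\<dots> = (\<Sum>i. ?d (?V S i) + ?d (?V T i))"
    by (rule suminf_add) auto
  also have "\<dots> \<le> (\<Sum>i. ?d (U i))"
  proof (rule suminf_le)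
    fix i
    have "U i \<inter> S = {} \<or> U i \<inter> T = {}"
    proof (rule ccontr)
      assume "\<not> ?thesis"
      then obtain x y where xy: "x \<in> U i" "x \<in> S" "y \<in> U i" "y \<in> T" by blast
      then have "dist x y \<le> diameter (U i)" using bd diameter_bounded_bound by blast
      with sep[of x y] xy bd show False by (meson not_less order.trans)
    qed
    then show "?d (?V S i) + ?d (?V T i) \<le> ?d (U i)" by auto
  qed auto
  finally show "hausdorff2_pre \<delta> S + hausdorff2_pre \<delta> T \<le> (\<Sum>i. ?d (U i))" .
qed

text \<open>An efficient covering of \<open>N\<close> is fattened to open balls. Each radius exceeds
  the diameter of the covering set by a positive margin, since that diameter may be 0, and the
  squared margins form a geometric series with sum \<open>q\<close>. Openness matters because
  removing \<open>W\<close> from a compact set leaves a compact set.\<close>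

lemma hausdorff2_null_open_cover:
  fixes N :: "'a::metric_space set"
  assumes null: "hausdorff2 N = 0" and \<delta>: "0 < \<delta>" and e: "0 < e"
  obtains W where "open W" "N \<subseteq> W" "hausdorff2_pre \<delta> W \<le> ennreal e"
proof -
  \<comment> \<open>Balls of radius at most \<open>\<delta> / 4 + \<delta> / 4\<close> have diameter
    at most \<delta>, and the factor 8 from bounding \<open>(2 * (d i + \<eta> i))\<^sup>2\<close>
    turns \<open>e / 16\<close> into \<open>e / 2\<close>.\<close>
  have "hausdorff2_pre (\<delta> / 4) N \<le> hausdorff2 N"
    using \<delta> by (intro hausdorff2_pre_le_hausdorff2) simp
  then have "hausdorff2_pre (\<delta> / 4) N < ennreal (e / 16)" using e null by simp
  then obtain U where U: "N \<subseteq> (\<Union>i. U i)" "\<And>i. bounded (U i)" "\<And>i. diameter (U i) \<le> \<delta> / 4"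
      "(\<Sum>i::nat. ennreal ((diameter (U i))\<^sup>2)) < ennreal (e / 16)"
    by (rule hausdorff2_pre_lessE) blast
  \<comment> \<open>The first bound yields margins of at most \<open>\<delta> / 4\<close>, the
    second makes their total contribution \<open>8 * q\<close> at most \<open>e / 2\<close>.\<close>
  define q where "q = min (\<delta>\<^sup>2 / 16) (e / 16)"
  have q: "0 < q" "q \<le> (\<delta> / 4)\<^sup>2" "q \<le> e / 16" using \<delta> e by (auto simp: q_def power_divide)
  define \<eta> where "\<eta> i = sqrt (q * (1/2) ^ Suc i)" for i
  have \<eta>: "0 < \<eta> i" "(\<eta> i)\<^sup>2 = q * (1/2) ^ Suc i" for i
    using q by (auto simp: \<eta>_def)
  have \<eta>\<delta>: "\<eta> i \<le> \<delta> / 4" for i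
  proof (rule power2_le_imp_le)
    have "q * (1/2) ^ Suc i \<le> q * 1" using q by (intro mult_left_mono power_le_one) auto
    then show "(\<eta> i)\<^sup>2 \<le> (\<delta> / 4)\<^sup>2" unfolding \<eta>(2) mult_1_right by (rule order.trans[OF _ q(2)])
  qed (use \<delta> in simp)
  define d where "d i = diameter (U i)" for i
  have d: "0 \<le> d i" "d i \<le> \<delta> / 4" for i using U by (auto simp: d_def diameter_ge_0)
  define B where "B i = ball (SOME x. x \<in> U i) (d i + \<eta> i)" for i
  have UB: "U i \<subseteq> B i" for i
  proof
    fix x assume x: "x \<in> U i"
    then have "(SOME x. x \<in> U i) \<in> U i" by (metis someI)
    then have "dist (SOME x. x \<in> U i) x \<le> d i"
      unfolding d_def using x U(2) diameter_bounded_bound by blast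
    then show "x \<in> B i" using \<eta>(1)[of i] by (simp add: B_def)
  qed
  have bB: "bounded (B i)" for i by (simp add: B_def)
  have dB: "diameter (B i) \<le> 2 * (d i + \<eta> i)" for i
  proof (rule diameter_le_dist)
    show "0 \<le> 2 * (d i + \<eta> i)" using d(1)[of i] \<eta>(1)[of i] by simp
    show "dist x y \<le> 2 * (d i + \<eta> i)" if "x \<in> B i" "y \<in> B i" for x y
      using that dist_triangle3[of x y "SOME x. x \<in> U i"] by (simp add: B_def)
  qed
  have sq: "ennreal ((diameter (B i))\<^sup>2) \<le> 8 * ennreal ((d i)\<^sup>2) + ennreal (8 * q) * ennreal ((1/2) ^ Suc i)" for i
  proof -
    have "(diameter (B i))\<^sup>2 \<le> (2 * (d i + \<eta> i))\<^sup>2"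
      by (intro power_mono dB diameter_ge_0 bB)
    also have "\<dots> \<le> 8 * (d i)\<^sup>2 + 8 * (\<eta> i)\<^sup>2"
      using zero_le_power2[of "d i - \<eta> i"] by (simp add: power2_eq_square algebra_simps)
    also have "\<dots> = 8 * (d i)\<^sup>2 + 8 * q * (1/2) ^ Suc i" by (simp add: \<eta>)
    finally have "ennreal ((diameter (B i))\<^sup>2) \<le> ennreal (8 * (d i)\<^sup>2 + 8 * q * (1/2) ^ Suc i)"
      by (rule ennreal_leI)
    also have "\<dots> = ennreal (8 * (d i)\<^sup>2) + ennreal (8 * q * (1/2) ^ Suc i)"
      using q by (intro ennreal_plus) auto
    finally show ?thesis using q by (simp add: ennreal_mult del: power_Suc)
  qed
  have "hausdorff2_pre \<delta> (\<Union>i. B i) \<le> (\<Sum>i. ennreal ((diameter (B i))\<^sup>2))"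
  proof (rule hausdorff2_pre_le)
    show "diameter (B i) \<le> \<delta>" for i using dB[of i] d(2)[of i] \<eta>\<delta>[of i] by simp
  qed (use bB in auto)
  also have "\<dots> \<le> (\<Sum>i. 8 * ennreal ((d i)\<^sup>2) + ennreal (8 * q) * ennreal ((1/2) ^ Suc i))"
    by (intro suminf_le sq) auto
  also have "\<dots> = 8 * (\<Sum>i. ennreal ((d i)\<^sup>2)) + ennreal (8 * q) * (\<Sum>i. ennreal ((1/2) ^ Suc i))"
    by (simp flip: suminf_add del: power_Suc)
  also have "(\<Sum>i. ennreal ((1/2) ^ Suc i)) = 1"
    by (subst suminf_ennreal_eq[OF _ power_half_series]) (auto simp del: power_Suc)
  also have "8 * (\<Sum>i. ennreal ((d i)\<^sup>2)) + ennreal (8 * q) * 1 \<le> 8 * ennreal (e / 16) + ennreal (e / 2)"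
    using U(4) q by (intro add_mono mult_left_mono) (auto simp: d_def intro: ennreal_leI)
  also have "\<dots> = ennreal e"
    using e by (simp flip: ennreal_plus ennreal_numeral ennreal_mult)
  finally have "hausdorff2_pre \<delta> (\<Union>i. B i) \<le> ennreal e" .
  moreover have "open (\<Union>i. B i)" by (auto simp: B_def)
  moreover have "N \<subseteq> (\<Union>i. B i)" using U(1) UB by blast
  ultimately show ?thesis using that by blast
qed

text \<open>Remove an open neighbourhood of \<open>A \<inter> B\<close> that is negligible at scale \<open>\<delta>\<close>: what remains of
  \<open>A\<close> and \<open>B\<close> lies at positive distance, where the premeasure is additive.\<close>

lemma hausdorff2_Un_null_Int:
  fixes A B :: "'a::heine_borel set"
  assumes A: "compact A" and B: "compact B" and null: "hausdorff2 (A \<inter> B) = 0"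
  shows "hausdorff2 (A \<union> B) = hausdorff2 A + hausdorff2 B"
proof (rule antisym[OF hausdorff2_Un])
  have *: "hausdorff2_pre \<delta> A + hausdorff2_pre \<delta> B \<le> hausdorff2 (A \<union> B)" if \<delta>: "0 < \<delta>" for \<delta>
  proof (rule ennreal_le_epsilon)
    fix e :: real assume e: "0 < e"
    obtain W where W: "open W" "A \<inter> B \<subseteq> W" "hausdorff2_pre \<delta> W \<le> ennreal (e / 2)"
      using hausdorff2_null_open_cover[OF null \<delta>, of "e / 2"] e by auto
    have "compact (A - W)" "closed (B - W)" "(A - W) \<inter> (B - W) = {}"
      using A B W by (auto intro: compact_diff compact_imp_closed closed_Diff)
    then obtain r where r: "0 < r" "\<And>x y. x \<in> A - W \<Longrightarrow> y \<in> B - W \<Longrightarrow> r \<le> dist x y"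
      using separate_compact_closed by metis
    \<comment> \<open>Strictly below the separation \<open>r\<close>, and no coarser than \<delta>,
      so that the premeasure at scale \<rho> dominates the one at scale \<delta>.\<close>
    define \<rho> where "\<rho> = min \<delta> (r / 2)"
    have \<rho>: "0 < \<rho>" "\<rho> \<le> \<delta>" "\<rho> < r" using r \<delta> by (auto simp: \<rho>_def)
    \<comment> \<open>Only \<open>S - W\<close> passes to the finer scale; the smallness of
      \<open>W\<close> is known at scale \<delta> alone.\<close>
    have split: "hausdorff2_pre \<delta> S \<le> hausdorff2_pre \<rho> (S - W) + ennreal (e / 2)" for S
    proof -
      have "hausdorff2_pre \<delta> S \<le> hausdorff2_pre \<delta> ((S - W) \<union> W)"
        by (intro hausdorff2_pre_mono) auto
      also have "\<dots> \<le> hausdorff2_pre \<delta> (S - W) + hausdorff2_pre \<delta> W"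
        by (rule hausdorff2_pre_Un)
      also have "\<dots> \<le> hausdorff2_pre \<rho> (S - W) + ennreal (e / 2)"
        by (intro add_mono W hausdorff2_pre_antimono \<rho>)
      finally show ?thesis .
    qed
    have "hausdorff2_pre \<delta> A + hausdorff2_pre \<delta> B
        \<le> (hausdorff2_pre \<rho> (A - W) + ennreal (e / 2)) + (hausdorff2_pre \<rho> (B - W) + ennreal (e / 2))"
      by (intro add_mono split)
    also have "\<dots> = (hausdorff2_pre \<rho> (A - W) + hausdorff2_pre \<rho> (B - W)) + (ennreal (e / 2) + ennreal (e / 2))"
      by (simp add: ac_simps)
    also have "ennreal (e / 2) + ennreal (e / 2) = ennreal e"
      using e by (simp flip: ennreal_plus)
    also have "hausdorff2_pre \<rho> (A - W) + hausdorff2_pre \<rho> (B - W) \<le> hausdorff2_pre \<rho> ((A - W) \<union> (B - W))"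
      using r \<rho> by (intro hausdorff2_pre_separated) (meson less_le_trans)
    also have "\<dots> \<le> hausdorff2_pre \<rho> (A \<union> B)" by (intro hausdorff2_pre_mono) auto
    also have "\<dots> \<le> hausdorff2 (A \<union> B)" by (intro hausdorff2_pre_le_hausdorff2 \<rho>)
    finally show "hausdorff2_pre \<delta> A + hausdorff2_pre \<delta> B \<le> hausdorff2 (A \<union> B) + ennreal e"
      by (simp add: add_right_mono)
  qed
  \<comment> \<open>The premeasure is antitone in the scale, so two scales can be replaced by their
    minimum and the sum of the suprema is the supremum of the sums.\<close>
  have "hausdorff2 A + hausdorff2 B = (SUP \<delta>\<in>{0<..}. hausdorff2_pre \<delta> A + hausdorff2_pre \<delta> B)"
    unfolding hausdorff2_def
  proof (rule SUP_add_directed_ennreal[symmetric])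
    fix \<delta> \<delta>' :: real assume "\<delta> \<in> {0<..}" "\<delta>' \<in> {0<..}"
    then show "\<exists>k\<in>{0<..}. hausdorff2_pre \<delta> A + hausdorff2_pre \<delta>' B
        \<le> hausdorff2_pre k A + hausdorff2_pre k B"
      by (intro bexI[of _ "min \<delta> \<delta>'"] add_mono hausdorff2_pre_antimono) auto
  qed
  also have "\<dots> \<le> hausdorff2 (A \<union> B)"
    by (intro SUP_least *) auto
  finally show "hausdorff2 A + hausdorff2 B \<le> hausdorff2 (A \<union> B)" .
qed

section \<open>Lipschitz maps, similarities and null sets\<close>

lemma hausdorff2_lipschitz_image:
  fixes f :: "'a::metric_space \<Rightarrow> 'b::metric_space"
  assumes L: "0 < L" and lip: "\<And>x y. x \<in> S \<Longrightarrow> y \<in> S \<Longrightarrow> dist (f x) (f y) \<le> L * dist x y"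
  shows "hausdorff2 (f ` S) \<le> ennreal (L\<^sup>2) * hausdorff2 S"
  unfolding hausdorff2_def[of "f ` S"]
proof (rule SUP_least)
  fix \<delta> :: real assume "\<delta> \<in> {0<..}"
  then have \<delta>: "0 < \<delta> / L" using L by simp
  \<comment> \<open>Dividing on the left leaves a bare infimum on the right, so it suffices to bound
    the quotient by each covering sum of \<open>S\<close>. Scale \<open>\<delta> / L\<close> is the
    one whose images have diameter at most \<delta>.\<close>
  have "hausdorff2_pre \<delta> (f ` S) / ennreal (L\<^sup>2) \<le> hausdorff2_pre (\<delta> / L) S"
    unfolding hausdorff2_pre_def[of "\<delta> / L"]
  proof (rule INF_greatest, clarify)
    fix U :: "nat \<Rightarrow> 'a set"
    assume cov: "S \<subseteq> (\<Union>i. U i)" and bd: "\<forall>i. bounded (U i) \<and> diameter (U i) \<le> \<delta> / L"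
    \<comment> \<open>The intersection with \<open>S\<close> is taken because the Lipschitz bound
      holds only there.\<close>
    define V where "V i = f ` (U i \<inter> S)" for i
    have dist: "dist x y \<le> L * diameter (U i)" if xy: "x \<in> V i" "y \<in> V i" for x y i
    proof -
      obtain a b where ab: "a \<in> U i" "a \<in> S" "x = f a" "b \<in> U i" "b \<in> S" "y = f b"
        using xy by (auto simp: V_def)
      have "dist x y \<le> L * dist a b" using ab lip by auto
      also have "\<dots> \<le> L * diameter (U i)"
        using ab bd L by (intro mult_left_mono diameter_bounded_bound) auto
      finally show ?thesis .
    qed
    have bV: "bounded (V i)" for i
      unfolding bounded_two_points using dist by blast
    have dV: "diameter (V i) \<le> L * diameter (U i)" for i
      using L bd by (intro diameter_le_dist dist) (simp_all add: diameter_ge_0)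
    have "hausdorff2_pre \<delta> (f ` S) \<le> (\<Sum>i. ennreal ((diameter (V i))\<^sup>2))"
    proof (rule hausdorff2_pre_le)
      show "f ` S \<subseteq> (\<Union>i. V i)" using cov unfolding V_def by blast
      fix i
      have "L * diameter (U i) \<le> \<delta>" using bd L by (simp add: field_simps)
      then show "diameter (V i) \<le> \<delta>" using dV order.trans by blast
    qed (rule bV)
    also have "\<dots> \<le> (\<Sum>i. ennreal (L\<^sup>2) * ennreal ((diameter (U i))\<^sup>2))"
    proof (rule suminf_le)
      fix i
      have "(diameter (V i))\<^sup>2 \<le> (L * diameter (U i))\<^sup>2"
        by (intro power_mono dV diameter_ge_0 bV)
      then show "ennreal ((diameter (V i))\<^sup>2) \<le> ennreal (L\<^sup>2) * ennreal ((diameter (U i))\<^sup>2)"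
        by (simp add: power_mult_distrib flip: ennreal_mult)
    qed auto
    also have "\<dots> = ennreal (L\<^sup>2) * (\<Sum>i. ennreal ((diameter (U i))\<^sup>2))" by simp
    finally show "hausdorff2_pre \<delta> (f ` S) / ennreal (L\<^sup>2) \<le> (\<Sum>i. ennreal ((diameter (U i))\<^sup>2))"
      using L by (intro divide_le_posI_ennreal) (auto simp: ac_simps)
  qed
  also have "\<dots> \<le> hausdorff2 S" by (rule hausdorff2_pre_le_hausdorff2[OF \<delta>])
  finally have "ennreal (L\<^sup>2) * (hausdorff2_pre \<delta> (f ` S) / ennreal (L\<^sup>2)) \<le> ennreal (L\<^sup>2) * hausdorff2 S"
    by (rule mult_left_mono) simp
  moreover have "ennreal (L\<^sup>2) * (hausdorff2_pre \<delta> (f ` S) / ennreal (L\<^sup>2)) = hausdorff2_pre \<delta> (f ` S)"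
    using L by (simp add: ennreal_times_divide ennreal_mult_divide_eq mult.commute[of "ennreal _"])
  ultimately show "hausdorff2_pre \<delta> (f ` S) \<le> ennreal (L\<^sup>2) * hausdorff2 S" by simp
qed

text \<open>The inverse of a similarity of ratio \<open>L\<close> is Lipschitz with constant
  \<open>1 / L\<close>, so the Lipschitz estimate in both directions gives equality.\<close>

lemma hausdorff2_similarity:
  fixes f :: "'a::metric_space \<Rightarrow> 'b::metric_space"
  assumes L: "0 < L" and f: "\<And>x y. x \<in> S \<Longrightarrow> y \<in> S \<Longrightarrow> dist (f x) (f y) = L * dist x y"
  shows "hausdorff2 (f ` S) = ennreal (L\<^sup>2) * hausdorff2 S"
proof (rule antisym)
  have inj: "inj_on f S"
  proof (rule inj_onI)
    fix x y assume "x \<in> S" "y \<in> S" "f x = f y"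
    then show "x = y" using f[of x y] L by simp
  qed
  have "hausdorff2 (inv_into S f ` f ` S) \<le> ennreal ((1 / L)\<^sup>2) * hausdorff2 (f ` S)"
    using L f inj by (intro hausdorff2_lipschitz_image) auto
  then have "ennreal (L\<^sup>2) * hausdorff2 S \<le> ennreal (L\<^sup>2) * (ennreal ((1 / L)\<^sup>2) * hausdorff2 (f ` S))"
    using inj by (intro mult_left_mono) auto
  also have "\<dots> = hausdorff2 (f ` S)"
    using L by (simp add: power_divide flip: mult.assoc ennreal_mult)
  finally show "ennreal (L\<^sup>2) * hausdorff2 S \<le> hausdorff2 (f ` S)" .
qed (use assms in \<open>auto intro: hausdorff2_lipschitz_image\<close>)

lemma hausdorff2_isometry:
  assumes "\<And>x y. x \<in> S \<Longrightarrow> y \<in> S \<Longrightarrow> dist (f x) (f y) = dist x y"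
  shows "hausdorff2 (f ` S) = hausdorff2 S"
  using hausdorff2_similarity[of 1 S f] assms by simp

text \<open>Covering by pieces of length \<open>1 / n\<close> costs about
  \<open>n * (1 / n)^2\<close>, which tends to 0.\<close>

lemma hausdorff2_unit_interval: "hausdorff2 {0..1::real} = 0"
proof -
  have "hausdorff2_pre \<delta> {0..1::real} \<le> 0" if \<delta>: "0 < \<delta>" for \<delta>
  proof (rule ennreal_le_epsilon)
    fix e :: real assume e: "0 < e"
    obtain n0 :: nat where n0: "max (1 / \<delta>) (2 / e) < real n0" using reals_Archimedean2 by blast
    define n where "n = Suc n0"
    have n: "0 < n" "1 / real n \<le> \<delta>" "2 / real n \<le> e"
      using n0 \<delta> e unfolding n_def by (auto simp: field_simps)
    \<comment> \<open>The floor takes the values 0 to \<open>n\<close>, the last only at the point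
      1; hence \<open>Suc n\<close> pieces.\<close>
    define U where "U k = {x \<in> {0..1::real}. nat \<lfloor>x * n\<rfloor> = k}" for k
    have dist: "dist x y \<le> 1 / n" if "x \<in> U k" "y \<in> U k" for x y k
    proof -
      have "\<lfloor>x * n\<rfloor> = \<lfloor>y * n\<rfloor>" using that unfolding U_def
        by (auto simp: nat_eq_iff)
      then have "\<bar>x * n - y * n\<bar> \<le> 1" by linarith
      then have "\<bar>x - y\<bar> * n \<le> 1" by (simp add: abs_mult flip: left_diff_distrib)
      then show ?thesis using n by (simp add: dist_real_def field_simps)
    qed
    have bU: "bounded (U k)" for k unfolding bounded_two_points using dist by blast
    have dU: "diameter (U k) \<le> 1 / n" for k
      by (rule diameter_le) (use dist in \<open>auto simp: dist_norm\<close>)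
    have empty: "U k = {}" if "k > n" for k
    proof -
      have "nat \<lfloor>x * n\<rfloor> \<le> n" if "x \<in> {0..1}" for x :: real
      proof -
        have "x * n \<le> 1 * real n" using that by (intro mult_right_mono) auto
        then show ?thesis by linarith
      qed
      then show ?thesis using that by (fastforce simp: U_def)
    qed
    have "hausdorff2_pre \<delta> {0..1::real} \<le> (\<Sum>k. ennreal ((diameter (U k))\<^sup>2))"
      by (rule hausdorff2_pre_le) (use dU n bU in \<open>auto simp: U_def intro: order.trans\<close>)
    also have "\<dots> = (\<Sum>k<Suc n. ennreal ((diameter (U k))\<^sup>2))"
      by (rule suminf_finite) (use empty in auto)
    also have "\<dots> \<le> (\<Sum>k<Suc n. ennreal ((1 / n)\<^sup>2))"
      by (intro sum_mono ennreal_leI power_mono dU diameter_ge_0 bU)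
    also have "\<dots> = ennreal (real (Suc n) * (1 / n)\<^sup>2)"
      by (simp add: ennreal_mult'' flip: ennreal_of_nat_eq_real_of_nat del: of_nat_Suc)
    also have "\<dots> \<le> ennreal e"
    proof (rule ennreal_leI)
      have "real (Suc n) * (1 / n)\<^sup>2 \<le> (2 * real n) * (1 / n)\<^sup>2" 
        using n by (intro mult_right_mono) auto
      also have "\<dots> = 2 / n" using n by (simp add: power2_eq_square)
      finally show "real (Suc n) * (1 / n)\<^sup>2 \<le> e" using n by simp
    qed
    finally show "hausdorff2_pre \<delta> {0..1::real} \<le> 0 + ennreal e" by simp
  qed
  then show ?thesis unfolding hausdorff2_def
    by (intro antisym SUP_least) auto
qed

lemma hausdorff2_null_subset: "hausdorff2 T = 0 \<Longrightarrow> S \<subseteq> T \<Longrightarrow> hausdorff2 S = 0"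
  using hausdorff2_mono[of S T] by simp

lemma hausdorff2_null_Un: "hausdorff2 S = 0 \<Longrightarrow> hausdorff2 T = 0 \<Longrightarrow> hausdorff2 (S \<union> T) = 0"
  using hausdorff2_Un[of S T] by simp

lemma hausdorff2_line_image:
  fixes p w :: "'a::real_normed_vector"
  shows "hausdorff2 ((\<lambda>t. p + t *\<^sub>R w) ` {c..d}) = 0"
proof -
  have "{c..d} \<subseteq> (\<lambda>t. c + t * (d - c)) ` {0..1}"
  proof
    fix t assume t: "t \<in> {c..d}"
    show "t \<in> (\<lambda>t. c + t * (d - c)) ` {0..1}"
    proof (cases "c = d")
      case False
      with t have "t = c + ((t - c) / (d - c)) * (d - c)" "(t - c) / (d - c) \<in> {0..1}"
        by auto
      then show ?thesis by blast
    qed (use t in \<open>auto intro: image_eqI[of _ _ 0]\<close>)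
  qed
  then have "(\<lambda>t. p + t *\<^sub>R w) ` {c..d} \<subseteq> (\<lambda>t. p + (c + t * (d - c)) *\<^sub>R w) ` {0..1}"
    by blast
  \<comment> \<open>The summand 1 keeps the Lipschitz constant positive when \<open>c = d\<close> or
    \<open>w = 0\<close>.\<close>
  moreover have "hausdorff2 ((\<lambda>t. p + (c + t * (d - c)) *\<^sub>R w) ` {0..1})
      \<le> ennreal ((\<bar>d - c\<bar> * norm w + 1)\<^sup>2) * hausdorff2 {0..1::real}"
  proof (rule hausdorff2_lipschitz_image)
    fix x y :: real
    have "dist (p + (c + x * (d - c)) *\<^sub>R w) (p + (c + y * (d - c)) *\<^sub>R w)
        = norm (((x - y) * (d - c)) *\<^sub>R w)"
      by (simp add: dist_norm algebra_simps flip: scaleR_left_diff_distrib)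
    also have "\<dots> = (\<bar>d - c\<bar> * norm w) * dist x y"
      by (simp add: abs_mult dist_real_def)
    also have "\<dots> \<le> (\<bar>d - c\<bar> * norm w + 1) * dist x y"
      by (intro mult_right_mono) auto
    finally show "dist (p + (c + x * (d - c)) *\<^sub>R w) (p + (c + y * (d - c)) *\<^sub>R w)
      \<le> (\<bar>d - c\<bar> * norm w + 1) * dist x y" .
  qed (intro add_nonneg_pos mult_nonneg_nonneg, auto)
  ultimately show ?thesis
    using hausdorff2_null_subset by (auto simp: hausdorff2_unit_interval)
qed

section \<open>Rectangles\<close>

text \<open>By Pythagoras the parametrisation preserves the product metric of the plane. Rectangles
  in the various coordinate planes of four-space thereby reduce to planar ones.\<close>

lemma hausdorff2_orthonormal_image:
  fixes p u w :: "'a::real_inner"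
  assumes u: "norm u = 1" and w: "norm w = 1" and uw: "u \<bullet> w = 0"
  shows "hausdorff2 ((\<lambda>(s, t). p + s *\<^sub>R u + t *\<^sub>R w) ` S) = hausdorff2 S"
proof (rule hausdorff2_isometry, clarify)
  fix s t s' t' :: real
  have "(p + s *\<^sub>R u + t *\<^sub>R w) - (p + s' *\<^sub>R u + t' *\<^sub>R w) = (s - s') *\<^sub>R u + (t - t') *\<^sub>R w"
    by (simp add: algebra_simps)
  moreover have "norm ((s - s') *\<^sub>R u + (t - t') *\<^sub>R w) = sqrt ((s - s')\<^sup>2 + (t - t')\<^sup>2)"
    using u w uw unfolding norm_eq_sqrt_inner
    by (simp add: inner_simps inner_commute[of w u] power2_eq_square)
  ultimately show "dist (p + s *\<^sub>R u + t *\<^sub>R w) (p + s' *\<^sub>R u + t' *\<^sub>R w) = dist (s, t) (s', t')"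
    unfolding dist_Pair_Pair dist_real_def power2_abs by (simp add: dist_norm)
qed

lemma hausdorff2_rectangle_translate:
  "hausdorff2 ({a..b} \<times> {c..d}) = hausdorff2 ({0..b - a} \<times> {0..d - c :: real})" for a b c d :: real
proof -
  have "{a..b} \<times> {c..d} = (\<lambda>x. x + (a, c)) ` ({0..b - a} \<times> {0..d - c})"
  proof (intro equalityI subsetI)
    fix x assume "x \<in> {a..b} \<times> {c..d}"
    then have "x - (a, c) \<in> {0..b - a} \<times> {0..d - c}" by (cases x) auto
    then have "(x - (a, c)) + (a, c) \<in> (\<lambda>x. x + (a, c)) ` ({0..b - a} \<times> {0..d - c})" by (rule imageI)
    then show "x \<in> (\<lambda>x. x + (a, c)) ` ({0..b - a} \<times> {0..d - c})" by simp
  qed auto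
  then show ?thesis by (simp add: hausdorff2_isometry)
qed

text \<open>Serves to cut rectangles along the second side as well, where splitting is available for
  the first.\<close>

lemma hausdorff2_rectangle_swap: "hausdorff2 (A \<times> B) = hausdorff2 (B \<times> A)"
  for A B :: "'a::metric_space set"
  by (subst product_swap[symmetric], subst hausdorff2_isometry)
     (auto simp: dist_prod_def add.commute)

lemma hausdorff2_rectangle_split:
  fixes a b d :: real
  assumes "0 \<le> a" "0 \<le> b"
  shows "hausdorff2 ({0..a + b} \<times> {0..d}) = hausdorff2 ({0..a} \<times> {0..d}) + hausdorff2 ({0..b} \<times> {0..d})"
proof -
  have "{0..a + b} \<times> {0..d} = {0..a} \<times> {0..d} \<union> {a..a + b} \<times> {0..d}"
    using assms by auto
  moreover have "{0..a} \<times> {0..d} \<inter> {a..a + b} \<times> {0..d} \<subseteq> (\<lambda>t. (a, 0) + t *\<^sub>R (0, 1)) ` {0..d}"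
    by auto
  then have "hausdorff2 ({0..a} \<times> {0..d} \<inter> {a..a + b} \<times> {0..d}) = 0"
    by (rule hausdorff2_null_subset[OF hausdorff2_line_image])
  ultimately show ?thesis
    by (simp add: hausdorff2_Un_null_Int compact_Times hausdorff2_rectangle_translate[of a])
qed

lemma hausdorff2_square:
  assumes "0 \<le> a"
  shows "hausdorff2 ({0..a} \<times> {0..a}) = ennreal (a\<^sup>2) * hausdorff2 ({0..1::real} \<times> {0..1::real})"
\<comment> \<open>A similarity needs a positive ratio, so the square reduced to a point is treated
  apart, as a degenerate segment.\<close>
proof (cases "a = 0")
  case True
  then have "{0..a} \<times> {0..a} \<subseteq> (\<lambda>t. (0, 0) + t *\<^sub>R (0, 1)) ` {0..0}" by auto
  then have "hausdorff2 ({0..a} \<times> {0..a}) = 0"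
    by (rule hausdorff2_null_subset[OF hausdorff2_line_image])
  then show ?thesis using True by simp
next
  case False
  with assms have a: "0 < a" by simp
  have eq: "{0..a} \<times> {0..a} = (\<lambda>x. a *\<^sub>R x) ` ({0..1} \<times> {0..1})"
  proof (intro equalityI subsetI)
    fix x assume "x \<in> {0..a} \<times> {0..a}"
    then have "(1 / a) *\<^sub>R x \<in> {0..1} \<times> {0..1}" using a by (cases x) auto
    then have "a *\<^sub>R (1 / a) *\<^sub>R x \<in> (\<lambda>x. a *\<^sub>R x) ` ({0..1} \<times> {0..1})" by (rule imageI)
    then show "x \<in> (\<lambda>x. a *\<^sub>R x) ` ({0..1} \<times> {0..1})" using a by simp
  qed (use a in \<open>auto simp: mult_left_le\<close>)
  have scale: "dist (a *\<^sub>R x) (a *\<^sub>R y) = a * dist x y" for x y :: "real \<times> real"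
    using a by (simp add: dist_norm flip: scaleR_right_diff_distrib)
  show ?thesis
    unfolding eq by (rule hausdorff2_similarity[OF a scale])
qed

lemma hausdorff2_unit_square_eq: "hausdorff2 unit_square = hausdorff2 ({0..1::real} \<times> {0..1::real})"
proof -
  have eq: "unit_square = (\<lambda>(s, t). 0 + s *\<^sub>R axis 1 1 + t *\<^sub>R axis 2 1) ` ({0..1} \<times> {0..1})"
  proof (intro equalityI subsetI)
    fix x :: "real^4" assume x: "x \<in> unit_square"
    then have "x = (\<lambda>(s, t). 0 + s *\<^sub>R axis 1 1 + t *\<^sub>R axis 2 1) (x$1, x$2)"
      by (simp add: unit_square_def vec_eq_iff forall_4 axis_def)
    then show "x \<in> (\<lambda>(s, t). 0 + s *\<^sub>R axis 1 1 + t *\<^sub>R axis 2 1) ` ({0..1} \<times> {0..1})"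
      using x by (intro image_eqI[of _ _ "(x$1, x$2)"]) (auto simp: unit_square_def)
  qed (auto simp: unit_square_def axis_def)
  show ?thesis
    unfolding eq by (rule hausdorff2_orthonormal_image) (simp_all add: inner_axis_axis)
qed

text \<open>A square of side \<open>a + b\<close> splits into squares of sides \<open>a\<close> and \<open>b\<close> and two congruent
  \<open>a \<times> b\<close> rectangles, which determines the measure of the latter.\<close>

lemma hausdorff2_rectangle:
  assumes ab: "0 \<le> a" "0 \<le> b"
  shows "hausdorff2 ({0..a} \<times> {0..b}) = ennreal (a * b) * hausdorff2 unit_square"
proof -
  let ?R = "\<lambda>a b :: real. hausdorff2 ({0..a} \<times> {0..b})"
  obtain c where c: "0 \<le> c" "hausdorff2 unit_square = ennreal c"
    using hausdorff2_unit_square(2) by (cases "hausdorff2 unit_square") auto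
  have sq: "?R s s = ennreal (s\<^sup>2 * c)" if "0 \<le> s" for s
    using that c by (simp add: hausdorff2_square ennreal_mult flip: hausdorff2_unit_square_eq)
  have "?R (a + b) (a + b) = ?R a (a + b) + ?R b (a + b)"
    using ab by (rule hausdorff2_rectangle_split)
  also have "?R a (a + b) = ?R a a + ?R a b"
    using hausdorff2_rectangle_split[OF ab, of a] by (metis hausdorff2_rectangle_swap)
  also have "?R b (a + b) = ?R a b + ?R b b"
    using hausdorff2_rectangle_split[OF ab, of b] by (metis hausdorff2_rectangle_swap)
  finally have eq: "ennreal ((a + b)\<^sup>2 * c) = (ennreal (a\<^sup>2 * c) + ?R a b) + (?R a b + ennreal (b\<^sup>2 * c))"
    using ab by (simp add: sq)
  \<comment> \<open>The rectangle fits into the square of side \<open>a + b\<close>, so its measure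
    is finite and the equation can be solved in the reals.\<close>
  have "?R a b \<le> ?R (a + b) (a + b)" using ab by (intro hausdorff2_mono) auto
  then have "?R a b < top" using ab by (simp add: sq order.strict_trans1)
  then obtain r where r: "0 \<le> r" "?R a b = ennreal r" by (cases "?R a b") auto
  have "(a + b)\<^sup>2 * c = (a\<^sup>2 * c + r) + (r + b\<^sup>2 * c)"
    using eq r c by (simp flip: ennreal_plus)
  then have "r = a * b * c" by (simp add: power2_eq_square algebra_simps)
  then show ?thesis using r c ab by (simp add: ennreal_mult)
qed

section \<open>Normalised area\<close>

lemma area_Un_null_Int:
  assumes "compact A" "compact B" "hausdorff2 (A \<inter> B) = 0"
  shows "area (A \<union> B) = area A + area B"
  unfolding area_def using assms
  by (simp add: hausdorff2_Un_null_Int add_divide_distrib_ennreal)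

lemma area_rectangle:
  fixes p u w :: "real^4"
  assumes "norm u = 1" "norm w = 1" "u \<bullet> w = 0" "a \<le> b" "c \<le> d"
  shows "area ((\<lambda>(s, t). p + s *\<^sub>R u + t *\<^sub>R w) ` ({a..b} \<times> {c..d})) = ennreal ((b - a) * (d - c))"
proof -
  have "area ((\<lambda>(s, t). p + s *\<^sub>R u + t *\<^sub>R w) ` ({a..b} \<times> {c..d}))
      = ennreal ((b - a) * (d - c)) * hausdorff2 unit_square / hausdorff2 unit_square"
    unfolding area_def hausdorff2_orthonormal_image[OF assms(1-3)]
      hausdorff2_rectangle_translate[of a]
    using assms by (simp add: hausdorff2_rectangle)
  then show ?thesis
    using hausdorff2_unit_square by (simp add: ennreal_mult_divide_eq)
qed

section \<open>Spinning edges and arcs\<close>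

text \<open>Coordinate inequalities, rather than a parametrisation, let unions and intersections
  with spun sets be checked pointwise; the parametrised form needed for measuring is recovered in
  \<open>axis_rectangle_eq_image\<close>.\<close>

definition axis_rectangle :: "4 \<Rightarrow> 4 \<Rightarrow> real^4 \<Rightarrow> real \<Rightarrow> real \<Rightarrow> real \<Rightarrow> real \<Rightarrow> (real^4) set" where
  "axis_rectangle i j p a b c d =
     {x. a \<le> x$i \<and> x$i \<le> b \<and> c \<le> x$j \<and> x$j \<le> d \<and> (\<forall>k. k \<noteq> i \<longrightarrow> k \<noteq> j \<longrightarrow> x$k = p$k)}"

lemma axis_rectangle_eq_image:
  assumes "i \<noteq> j"
  shows "axis_rectangle i j p a b c d =
    (\<lambda>(s, t). (p - p$i *\<^sub>R axis i 1 - p$j *\<^sub>R axis j 1) + s *\<^sub>R axis i 1 + t *\<^sub>R axis j 1) ` ({a..b} \<times> {c..d})"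
    (is "_ = ?f ` _")
proof (intro equalityI subsetI)
  fix x assume x: "x \<in> axis_rectangle i j p a b c d"
  then have "x = ?f (x$i, x$j)"
    using assms by (auto simp: axis_rectangle_def vec_eq_iff axis_def)
  then show "x \<in> ?f ` ({a..b} \<times> {c..d})"
    using x by (intro image_eqI[of _ _ "(x$i, x$j)"]) (auto simp: axis_rectangle_def)
qed (use assms in \<open>auto simp: axis_rectangle_def axis_def\<close>)

lemma compact_axis_rectangle: "i \<noteq> j \<Longrightarrow> compact (axis_rectangle i j p a b c d)"
  unfolding axis_rectangle_eq_image case_prod_beta
  by (intro compact_continuous_image continuous_intros compact_Times) auto

lemma area_axis_rectangle:
  assumes "i \<noteq> j" "a \<le> b" "c \<le> d"
  shows "area (axis_rectangle i j p a b c d) = ennreal ((b - a) * (d - c))"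
  using assms by (simp add: axis_rectangle_eq_image area_rectangle inner_axis_axis)

lemma hausdorff2_axis_segment: "hausdorff2 {x::real^4. c \<le> x$j \<and> x$j \<le> d \<and> (\<forall>k. k \<noteq> j \<longrightarrow> x$k = p$k)} = 0"
proof (rule hausdorff2_null_subset[OF hausdorff2_line_image])
  show "{x::real^4. c \<le> x$j \<and> x$j \<le> d \<and> (\<forall>k. k \<noteq> j \<longrightarrow> x$k = p$k)}
    \<subseteq> (\<lambda>t. (p - p$j *\<^sub>R axis j 1) + t *\<^sub>R axis j 1) ` {c..d}"
    by (auto simp: vec_eq_iff axis_def intro!: image_eqI[where x = "_ $ j"])
qed

section \<open>The spin operation on sets\<close>

lemma cspin_Un: "cspin (A \<union> B) = cspin A \<union> cspin B"
  and cspin_Int: "cspin (A \<inter> B) = cspin A \<inter> cspin B"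
  and cspin_mono: "A \<subseteq> B \<Longrightarrow> cspin A \<subseteq> cspin B"
  by (auto simp: cspin_def)

text \<open>The spin is the preimage of a closed set under the continuous folding map
  \<open>?f\<close>, and folding cannot hide large coordinates, since the maximum bounds both of the
  last two.\<close>

lemma compact_cspin:
  assumes "compact A"
  shows "compact (cspin A)"
proof -
  let ?f = "\<lambda>x::real^4. vector [x$1, x$2, max \<bar>x$3\<bar> \<bar>x$4\<bar>, 0] :: real^4"
  have f: "?f = (\<lambda>x. x$1 *\<^sub>R axis 1 1 + x$2 *\<^sub>R axis 2 1 + max \<bar>x$3\<bar> \<bar>x$4\<bar> *\<^sub>R axis 3 1)"
    by (simp add: fun_eq_iff vec_eq_iff forall_4 axis_def)
  have "continuous_on UNIV ?f" unfolding f by (intro continuous_intros)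
  then have "closed (?f -` A)"
    using assms by (intro closed_vimage compact_imp_closed)
  moreover have "cspin A = ?f -` A" by (auto simp: cspin_def)
  ultimately have "closed (cspin A)" by simp
  moreover obtain B where B: "\<And>y. y \<in> A \<Longrightarrow> norm y \<le> B"
    using assms compact_imp_bounded bounded_iff by metis
  \<comment> \<open>All four coordinates are bounded by \<open>B\<close>, and the norm by the sum of
    their absolute values.\<close>
  have "norm x \<le> 4 * B" if "x \<in> cspin A" for x
  proof -
    have "\<bar>?f x $ k\<bar> \<le> B" for k
      using B[of "?f x"] that component_le_norm_cart[of "?f x" k] by (simp add: cspin_def)
    from this[of 1] this[of 2] this[of 3] norm_le_l1_cart[of x] show ?thesis
      by (simp add: sum_4)
  qed
  then have "bounded (cspin A)" by (auto simp: bounded_iff)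
  ultimately show ?thesis by (simp add: compact_eq_bounded_closed)
qed

text \<open>The four alternatives are the sides of the boundary of the square of side
  \<open>2 * z\<close>; for negative \<open>z\<close> both sides of the equivalence fail.\<close>

lemma max_abs_eq_iff:
  fixes s t z :: real
  shows "max \<bar>s\<bar> \<bar>t\<bar> = z \<longleftrightarrow>
    s = z \<and> \<bar>t\<bar> \<le> z \<or> s = - z \<and> \<bar>t\<bar> \<le> z \<or> t = z \<and> \<bar>s\<bar> \<le> z \<or> t = - z \<and> \<bar>s\<bar> \<le> z"
  by linarith

text \<open>Four segments, the sides of a square, contain the spin. An inclusion is enough, and it
  also covers points outside the half-space, whose spin is empty.\<close>

lemma hausdorff2_cspin_singleton: "hausdorff2 (cspin {p}) = 0"
proof -
  let ?z = "p $ 3"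
  let ?L = "\<lambda>j q. {x::real^4. - ?z \<le> x$j \<and> x$j \<le> ?z \<and> (\<forall>k. k \<noteq> j \<longrightarrow> x$k = q$k)}"
  let ?N = "?L 4 (vector [p$1, p$2, ?z, 0]) \<union> ?L 4 (vector [p$1, p$2, - ?z, 0])
    \<union> ?L 3 (vector [p$1, p$2, 0, ?z]) \<union> ?L 3 (vector [p$1, p$2, 0, - ?z])"
  have "hausdorff2 ?N = 0" by (intro hausdorff2_null_Un hausdorff2_axis_segment)
  moreover have "cspin {p} \<subseteq> ?N"
    unfolding cspin_def vec_eq_iff singleton_iff forall_4 vector_4 max_abs_eq_iff
    by (auto simp: forall_4 abs_le_iff)
  ultimately show ?thesis by (rule hausdorff2_null_subset)
qed

section \<open>Areas of spun edges\<close>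

lemma closed_segment_axis:
  fixes p :: "real^'n"
  assumes "0 \<le> c"
  shows "closed_segment p (p + c *\<^sub>R axis j 1)
    = {x. p$j \<le> x$j \<and> x$j \<le> p$j + c \<and> (\<forall>k. k \<noteq> j \<longrightarrow> x$k = p$k)}"
proof (intro equalityI subsetI)
  fix x assume "x \<in> closed_segment p (p + c *\<^sub>R axis j 1)"
  then obtain u where u: "0 \<le> u" "u \<le> 1" "x = p + (u * c) *\<^sub>R axis j 1"
    by (auto simp: in_segment algebra_simps)
  with assms show "x \<in> {x. p$j \<le> x$j \<and> x$j \<le> p$j + c \<and> (\<forall>k. k \<noteq> j \<longrightarrow> x$k = p$k)}"
    by (auto simp: axis_def mult_left_le_one_le)
next
  fix x assume x: "x \<in> {x. p$j \<le> x$j \<and> x$j \<le> p$j + c \<and> (\<forall>k. k \<noteq> j \<longrightarrow> x$k = p$k)}"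
  \<comment> \<open>For \<open>c = 0\<close> division by zero gives \<open>u = 0\<close>, which is a
    correct parameter because then \<open>x$j = p$j\<close>.\<close>
  define u where "u = (x$j - p$j) / c"
  have uc: "u * c = x$j - p$j" using x assms by (auto simp: u_def)
  have "x = p + (u * c) *\<^sub>R axis j 1"
    unfolding uc using x by (auto simp: vec_eq_iff axis_def)
  moreover have "0 \<le> u" "u \<le> 1" using x assms by (auto simp: u_def divide_le_eq_1)
  ultimately show "x \<in> closed_segment p (p + c *\<^sub>R axis j 1)"
    by (auto simp: in_segment algebra_simps)
qed

text \<open>The large square is the union of the spun edge and the small square, which meet only
  within the spin of \<open>p\<close>; additivity then gives an equation for the unknown area. At
  height 0 the small square is a point, so edges starting on the boundary plane are
  included.\<close>

lemma area_cspin_vertical: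
  fixes p :: "real^4"
  assumes p: "0 \<le> p$3" "p$4 = 0" and c: "0 \<le> c"
  shows "area (cspin (closed_segment p (p + c *\<^sub>R axis 3 1))) = ennreal (4 * c * (2 * p$3 + c))"
proof -
  define A where "A = cspin (closed_segment p (p + c *\<^sub>R axis 3 1))"
  let ?S = "\<lambda>s. axis_rectangle 3 4 p (- s) s (- s) s"
  have S: "area (?S s) = ennreal (4 * s\<^sup>2)" if "0 \<le> s" for s
    using that by (simp add: area_axis_rectangle power2_eq_square algebra_simps)
  have A: "A = {x. x$1 = p$1 \<and> x$2 = p$2 \<and> p$3 \<le> max \<bar>x$3\<bar> \<bar>x$4\<bar> \<and> max \<bar>x$3\<bar> \<bar>x$4\<bar> \<le> p$3 + c}"
    unfolding A_def closed_segment_axis[OF c] cspin_def using p(2) by (auto simp: forall_4)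
  have "?S (p$3 + c) = A \<union> ?S (p$3)"
    unfolding A axis_rectangle_def using c by (auto simp: forall_4)
  moreover have "A \<inter> ?S (p$3) \<subseteq> cspin {p}"
    unfolding A axis_rectangle_def cspin_def using p by (auto simp: forall_4 vec_eq_iff)
  then have "hausdorff2 (A \<inter> ?S (p$3)) = 0"
    by (rule hausdorff2_null_subset[OF hausdorff2_cspin_singleton])
  then have "area (A \<union> ?S (p$3)) = area A + area (?S (p$3))"
    by (intro area_Un_null_Int) (auto simp: A_def compact_cspin compact_axis_rectangle)
  ultimately have eq: "ennreal (4 * (p$3 + c)\<^sup>2) = area A + ennreal (4 * (p$3)\<^sup>2)"
    using S[of "p$3 + c"] S[of "p$3"] p c by simp
  then have "area A \<noteq> top" by (metis ennreal_neq_top ennreal_add_eq_top)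
  then obtain r where r: "0 \<le> r" "area A = ennreal r" by (cases "area A") auto
  have "4 * (p$3 + c)\<^sup>2 = r + 4 * (p$3)\<^sup>2"
    using eq r by (simp flip: ennreal_plus)
  then have "r = 4 * c * (2 * p$3 + c)" by (simp add: power2_eq_square algebra_simps)
  with r show ?thesis by (simp add: A_def)
qed

lemma area_cspin_horizontal:
  fixes p :: "real^4"
  assumes j: "j = 1 \<or> j = 2" and p: "0 \<le> p$3" "p$4 = 0" and c: "0 \<le> c"
  shows "area (cspin (closed_segment p (p + c *\<^sub>R axis j 1))) = ennreal (8 * c * p$3)"
proof -
  let ?z = "p$3"
  define R where "R i q = axis_rectangle j i q (p$j) (p$j + c) (- ?z) ?z" for i q
  define A B A' B' where "A = R 4 (vector [p$1, p$2, ?z, 0])"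
    and "B = R 4 (vector [p$1, p$2, - ?z, 0])"
    and "A' = R 3 (vector [p$1, p$2, 0, ?z])"
    and "B' = R 3 (vector [p$1, p$2, 0, - ?z])"
  have ne: "j \<noteq> 3" "j \<noteq> 4" using j by auto
  have cpt: "compact A" "compact B" "compact A'" "compact B'"
    using ne by (auto simp: A_def B_def A'_def B'_def R_def compact_axis_rectangle)
  have area: "area A = ennreal (2 * c * ?z)" "area B = ennreal (2 * c * ?z)"
    "area A' = ennreal (2 * c * ?z)" "area B' = ennreal (2 * c * ?z)"
    using ne p c by (auto simp: A_def B_def A'_def B'_def R_def area_axis_rectangle algebra_simps)
  define I where "I x \<longleftrightarrow> p$j \<le> x$j \<and> x$j \<le> p$j + c \<and> (\<forall>k\<in>{1, 2}. k \<noteq> j \<longrightarrow> x$k = p$k)"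
    for x :: "real^4"
  have mem: "A = {x. I x \<and> x$3 = ?z \<and> \<bar>x$4\<bar> \<le> ?z}" "B = {x. I x \<and> x$3 = - ?z \<and> \<bar>x$4\<bar> \<le> ?z}"
    "A' = {x. I x \<and> x$4 = ?z \<and> \<bar>x$3\<bar> \<le> ?z}" "B' = {x. I x \<and> x$4 = - ?z \<and> \<bar>x$3\<bar> \<le> ?z}"
    unfolding A_def B_def A'_def B'_def R_def I_def axis_rectangle_def
    using j by (auto simp: forall_4 abs_le_iff)
  let ?L = "\<lambda>s t. {x::real^4. p$j \<le> x$j \<and> x$j \<le> p$j + c \<and> (\<forall>k. k \<noteq> j \<longrightarrow> x$k = vector [p$1, p$2, s, t] $ k)}"
  define K where "K = ?L ?z ?z \<union> ?L ?z (- ?z) \<union> ?L (- ?z) ?z \<union> ?L (- ?z) (- ?z)"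
  have K: "hausdorff2 K = 0"
    unfolding K_def by (intro hausdorff2_null_Un hausdorff2_axis_segment)
  have L: "?L s t = {x. I x \<and> x$3 = s \<and> x$4 = t}" for s t
    using j by (auto simp: I_def forall_4)
  \<comment> \<open>Adjacent rectangles meet above a corner of the square. Opposite ones meet only
    if \<open>?z = 0\<close>, when all four collapse to one segment contained in
    \<open>K\<close>.\<close>
  have int: "A \<inter> B \<subseteq> K" "A' \<inter> B' \<subseteq> K" "(A \<union> B) \<inter> (A' \<union> B') \<subseteq> K"
    unfolding mem K_def L by auto
  have "cspin (closed_segment p (p + c *\<^sub>R axis j 1)) = {x. I x \<and> max \<bar>x$3\<bar> \<bar>x$4\<bar> = ?z}"
    unfolding closed_segment_axis[OF c] cspin_def I_def using j p(2) by (auto simp: forall_4)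
  also have "\<dots> = (A \<union> B) \<union> (A' \<union> B')"
    unfolding mem max_abs_eq_iff by blast
  finally have "cspin (closed_segment p (p + c *\<^sub>R axis j 1)) = (A \<union> B) \<union> (A' \<union> B')" .
  moreover have "area ((A \<union> B) \<union> (A' \<union> B')) = (area A + area B) + (area A' + area B')"
    using cpt int K by (simp add: area_Un_null_Int hausdorff2_null_subset compact_Un)
  ultimately show ?thesis using area p c by (simp flip: ennreal_plus add: algebra_simps)
qed

text \<open>The formula is symmetric in \<open>p\<close> and \<open>q\<close>, so an edge running in
  the negative direction is handled by exchanging its end-points.\<close>

lemma area_cspin_segment:
  fixes p q :: "real^4"
  assumes j: "j \<in> {1, 2, 3}" and qp: "q - p = c *\<^sub>R axis j 1"
    and p: "0 \<le> p$3" "p$4 = 0" and q: "0 \<le> q$3" "q$4 = 0"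
  shows "area (cspin (closed_segment p q)) = ennreal (4 * norm (q - p) * (p$3 + q$3))"
proof -
  have *: "area (cspin (closed_segment p (p + c *\<^sub>R axis j 1)))
      = ennreal (4 * c * (p$3 + (p + c *\<^sub>R axis j 1)$3))" if "0 \<le> c" "0 \<le> p$3" "p$4 = 0" for c and p :: "real^4"
  proof (cases "j = 3")
    case True
    with area_cspin_vertical[of p c] that show ?thesis by (simp add: axis_def algebra_simps)
  next
    case False
    with area_cspin_horizontal[of j p c] that j show ?thesis
      by (auto simp: axis_def algebra_simps)
  qed
  show ?thesis
  proof (cases "0 \<le> c")
    case True
    moreover have "q = p + c *\<^sub>R axis j 1" using qp by (simp add: algebra_simps)
    ultimately show ?thesis using *[of c p] p by simp
  next
    case False
    moreover have "p = q + (- c) *\<^sub>R axis j 1" using qp by (simp add: algebra_simps)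
    ultimately have "area (cspin (closed_segment q p)) = ennreal (4 * (- c) * (q$3 + p$3))"
      using *[of "- c" q] q by simp
    then show ?thesis using False qp by (simp add: closed_segment_commute add.commute)
  qed
qed

section \<open>Spins of polygonal paths\<close>

lemma pathstart_polygonal_path [simp]: "vs \<noteq> [] \<Longrightarrow> pathstart (polygonal_path vs) = hd vs"
  by (induction vs rule: polygonal_path.induct) auto

text \<open>Injectivity of the arc makes each edge meet the later ones in a single vertex, whose spin is
  a null set, so areas of the spun edges add up.\<close>

lemma area_cspin_polygonal_path:
  assumes "2 \<le> length vs" and "arc (polygonal_path vs)"
    and "successively (\<lambda>p q. norm (q - p) = h \<and> (\<exists>j\<in>{1, 2, 3}. \<exists>c. q - p = c *\<^sub>R axis j 1)) vs"
    and "\<And>p. p \<in> set vs \<Longrightarrow> 0 \<le> p$3 \<and> p$4 = 0"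
  shows "area (cspin (path_image (polygonal_path vs)))
    = ennreal (4 * h * (\<Sum>i<length vs - 1. vs!i$3 + vs!Suc i$3))"
  using assms
proof (induction vs rule: polygonal_path.induct)
  case (3 a b)
  then show ?case using area_cspin_segment by fastforce
next
  case (4 a b c vs)
  let ?q = "polygonal_path (b # c # vs)"
  let ?S = "\<Sum>i<length (b # c # vs) - 1. (b # c # vs)!i$3 + (b # c # vs)!Suc i$3"
  have arc: "arc ?q" "closed_segment a b \<inter> path_image ?q \<subseteq> {b}"
    using "4.prems"(2) by (simp_all add: arc_join_eq)
  have h: "0 \<le> h" using "4.prems"(3) by auto
  \<comment> \<open>Nonnegativity allows the sum of two \<open>ennreal\<close> areas to be merged
    into one real expression.\<close>
  have S: "0 \<le> ?S"
    using "4.prems"(4) by (intro sum_nonneg add_nonneg_nonneg) (auto simp: nth_Cons split: nat.split)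
  have ab: "area (cspin (closed_segment a b)) = ennreal (4 * h * (a$3 + b$3))"
  proof -
    obtain j c' where "j \<in> {1, 2, 3}" "b - a = c' *\<^sub>R axis j 1" "norm (b - a) = h"
      using "4.prems"(3) unfolding successively.simps by blast
    then show ?thesis using area_cspin_segment[of j b a c'] "4.prems"(4) by simp
  qed
  have IH: "area (cspin (path_image ?q)) = ennreal (4 * h * ?S)"
    using "4.prems" arc by (intro "4.IH") auto
  have "hausdorff2 (cspin (closed_segment a b) \<inter> cspin (path_image ?q)) = 0"
    using hausdorff2_null_subset[OF hausdorff2_cspin_singleton cspin_mono[OF arc(2)]]
    by (simp add: cspin_Int)
  then have "area (cspin (closed_segment a b \<union> path_image ?q))
      = area (cspin (closed_segment a b)) + area (cspin (path_image ?q))"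
    unfolding cspin_Un
    by (intro area_Un_null_Int compact_cspin compact_path_image arc_imp_path arc) auto
  also have "\<dots> = ennreal (4 * h * (a$3 + b$3) + 4 * h * ?S)"
    unfolding ab IH using h S "4.prems"(4) by (intro ennreal_plus[symmetric]) auto
  also have "4 * h * (a$3 + b$3) + 4 * h * ?S = 4 * h * (a$3 + b$3 + ?S)"
    by (simp add: algebra_simps)
  also have "a$3 + b$3 + ?S = (\<Sum>i<length (a # b # c # vs) - 1. (a # b # c # vs)!i$3 + (a # b # c # vs)!Suc i$3)"
    by (simp add: sum.lessThan_Suc_shift del: sum.lessThan_Suc)
  finally show ?case by (simp add: path_image_join)
qed auto

theorem theorem2:
  fixes lam n :: nat and v :: "nat \<Rightarrow> real^4"
  assumes "1 \<le> lam"
    and "subcubical_arc lam v n"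
  shows "area (cspin (path_image (vertex_path v n)))
           = ennreal (8 / real lam * (\<Sum>i = 2..n-1. v i $ 3))"
proof -
  let ?vs = "map v [1..<Suc n]"
  have arc: "2 \<le> n" "arc (polygonal_path ?vs)"
    and edge: "\<And>i. i \<in> {1..n-1} \<Longrightarrow> norm (v (i+1) - v i) = 1 / real lam \<and>
        (\<exists>j\<in>{1, 2, 3::4}. \<exists>c::real. v (i+1) - v i = c *\<^sub>R axis j 1)"
    and ends: "v 1 $ 3 = 0" "v 1 $ 4 = 0" "v n $ 3 = 0" "v n $ 4 = 0"
    and inner: "\<And>i. i \<in> {2..n-1} \<Longrightarrow> 0 \<le> v i $ 3 \<and> v i $ 4 = 0"
    using assms(2) unfolding subcubical_arc_def vertex_path_def half_space_def half_space_boundary_def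
    by auto
  have "successively (\<lambda>p q. norm (q - p) = 1 / real lam \<and> (\<exists>j\<in>{1, 2, 3}. \<exists>c. q - p = c *\<^sub>R axis j 1)) ?vs"
    unfolding successively_conv_nth using edge by (auto simp del: upt_Suc)
  moreover have "0 \<le> p$3 \<and> p$4 = 0" if p: "p \<in> set ?vs" for p
  proof -
    obtain i where i: "p = v i" "1 \<le> i" "i \<le> n" using p by (auto simp del: upt_Suc)
    then consider "i = 1" | "i = n" | "i \<in> {2..n-1}" by fastforce
    then show ?thesis using ends inner i(1) by cases auto
  qed
  ultimately have "area (cspin (path_image (vertex_path v n)))
      = ennreal (4 * (1 / real lam) * (\<Sum>i<length ?vs - 1. ?vs!i$3 + ?vs!Suc i$3))"
    unfolding vertex_path_def using arc by (intro area_cspin_polygonal_path) auto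
  \<comment> \<open>List positions start at 0 and vertices at 1, so position \<open>i\<close> holds
    \<open>v (i+1)\<close>.\<close>
  also have "(\<Sum>i<length ?vs - 1. ?vs!i$3 + ?vs!Suc i$3) = (\<Sum>i<n-1. v (i+1) $ 3 + v (i+2) $ 3)"
    by (intro sum.cong) (auto simp del: upt_Suc)
  also have "\<dots> = 2 * (\<Sum>i = 2..n-1. v i $ 3)"
  proof -
    \<comment> \<open>Here \<open>m\<close> counts the inner vertices, so there are
      \<open>m + 1\<close> edges. The sum over first end-points loses its initial term, at
      \<open>v 1\<close>, and the sum over second end-points its final term, at
      \<open>v n\<close>.\<close>
    obtain m where n: "n = m + 2" using arc(1) by (metis add.commute le_Suc_ex)
    have "(\<Sum>i<Suc m. v (i+1) $ 3) = (\<Sum>i<m. v (i+2) $ 3)"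
      unfolding sum.lessThan_Suc_shift using ends by simp
    moreover have "(\<Sum>i<Suc m. v (i+2) $ 3) = (\<Sum>i<m. v (i+2) $ 3)"
      using ends n by simp
    moreover have "(\<Sum>i<m. v (i+2) $ 3) = (\<Sum>i = 2..n-1. v i $ 3)"
      by (rule sum.reindex_bij_witness[of _ "\<lambda>i. i - 2" "\<lambda>i. i + 2"]) (auto simp: n)
    ultimately show ?thesis by (simp add: n sum.distrib del: sum.lessThan_Suc)
  qed
  finally show ?thesis by simp
qed

end
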